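(* Let $T\in\mathbb{R}^{n\times n}$ be a symmetric tridiagonal matrix all of whose entries on the first upper diagonal (equivalently, on the first lower diagonal) are nonzero. Let $p(x)\in\mathbb{R}[x]$ be a polynomial with no multiple root such that $$p(x)=\det(J)\,\det(xJ-T),$$ where $J\in\mathbb{R}^{n\times n}$ is a signature matrix whose last diagonal entry is $+1$. Then the number of real roots of $p(x)$ is greater than or equal to $\operatorname{sgn}(J)$.
   Context: A signature matrix is a diagonal matrix with diagonal entries in $\{-1,+1\}$. For a real symmetric matrix $A$, $\operatorname{sgn}(A)$ denotes its signature: the number of positive eigenvalues minus the number of negative eigenvalues, counted with multiplicity. "No multiple root" means no multiple complex root. *)

theory Defs
  imports "Jordan_Normal_Form.Char_Poly"
begin

definition tridiagonal_mat :: "'a::zero mat \<Rightarrow> bool" where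
  "tridiagonal_mat A \<longleftrightarrow>
     (\<forall>i < dim_row A. \<forall>j < dim_col A. i + 1 < j \<or> j + 1 < i \<longrightarrow> A $$ (i, j) = 0)"

definition signature_mat :: "'a::comm_ring_1 mat \<Rightarrow> bool" where
  "signature_mat J \<longleftrightarrow>
     square_mat J \<and> diagonal_mat J \<and> (\<forall>i < dim_row J. J $$ (i, i) \<in> {-1, 1})"

text \<open>Meant for symmetric matrices only: their complex eigenvalues are all real, and the
  algebraic multiplicity used here agrees with the geometric one.\<close>

definition signature :: "real mat \<Rightarrow> int" where
  "signature A =
     int (\<Sum>a | eigenvalue A a \<and> a > 0. Polynomial.order a (char_poly A)) -
     int (\<Sum>a | eigenvalue A a \<and> a < 0. Polynomial.order a (char_poly A))"

text \<open>\<open>x J - T\<close> as a matrix over the polynomial ring, \<open>x = [:0, 1:]\<close> being the indeterminate;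
  its determinant is a polynomial, not a function of \<open>x\<close>.\<close>

definition linear_pencil :: "'a::comm_ring_1 mat \<Rightarrow> 'a mat \<Rightarrow> 'a poly mat" where
  "linear_pencil J T = [:0, 1:] \<cdot>\<^sub>m map_mat (\<lambda>a. [:a:]) J - map_mat (\<lambda>a. [:a:]) T"

end

theory Submission
  imports Defs
begin

text \<open>
  Let \<open>d\<^sub>k\<close> be the leading principal minor of size \<open>k\<close> of \<open>x J - T\<close>. Tridiagonality gives a
  three-term recurrence that expresses \<open>d\<^sub>k\<^sub>+\<^sub>2\<close> by \<open>d\<^sub>k\<^sub>+\<^sub>1\<close> and \<open>d\<^sub>k\<close>, where the coefficient of
  \<open>d\<^sub>k\<close> is minus the square of a nonzero off-diagonal entry (\<open>det_tridiagonal\<close>). So two consecutive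
  minors never vanish together, and where an inner minor vanishes its two neighbours have opposite
  signs: the \<open>d\<^sub>k\<close> form a Sturm chain (\<open>sturm_chain_continuant\<close>).

  Let \<open>V(x)\<close> be the number of sign variations in \<open>d\<^sub>0(x), \<dots>, d\<^sub>n(x)\<close>. A sign change of an inner
  minor leaves \<open>V\<close> alone, because it only moves the variation from one side of that minor to the
  other. Hence \<open>V\<close> can change only at the roots of \<open>d\<^sub>n\<close>, and there by at most one, since only the
  last pair of the chain is affected. When \<open>J\<close> is indefinite these changes may go in either
  direction and cancel, which is why the bound is an inequality.
  It follows that \<open>d\<^sub>n\<close> has at least \<open>V(a) - V(b)\<close> roots for \<open>a \<le> b\<close> (\<open>variations_drop_le_card_zeros\<close>).

  For large \<open>\<bar>x\<bar>\<close> the diagonal term dominates the recurrence, so that \<open>d\<^sub>k\<^sub>+\<^sub>1 / d\<^sub>k\<close> has the sign of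
  \<open>x\<close> times the \<open>k\<close>-th diagonal entry of \<open>J\<close>. Therefore \<open>V\<close> counts the entries \<open>1\<close> of \<open>J\<close> near
  \<open>-\<infinity>\<close> and the entries \<open>-1\<close> near \<open>\<infinity>\<close> (\<open>variations_continuant_far_out\<close>). The difference is the
  signature of \<open>J\<close>, and the roots of \<open>d\<^sub>n\<close> are those of \<open>p\<close>.
\<close>

section \<open>Determinants of tridiagonal matrices\<close>

text \<open>
  The determinant of a tridiagonal matrix with diagonal \<open>a\<close>, as a function of its size; \<open>c i\<close> is the
  product of the two off-diagonal entries that link \<open>i\<close> and \<open>i + 1\<close>.
\<close>

fun continuant :: "(nat \<Rightarrow> 'a::comm_ring_1) \<Rightarrow> (nat \<Rightarrow> 'a) \<Rightarrow> nat \<Rightarrow> 'a" where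
  "continuant a c 0 = 1"
| "continuant a c (Suc 0) = a 0"
| "continuant a c (Suc (Suc k)) =
     a (Suc k) * continuant a c (Suc k) - c k * continuant a c k"

lemma continuant_cong:
  assumes "\<And>i. i < n \<Longrightarrow> a i = a' i" and "\<And>i. Suc i < n \<Longrightarrow> c i = c' i"
  shows "continuant a c n = continuant a' c' n"
  using assms by (induction a c n rule: continuant.induct) auto

lemma poly_continuant:
  "poly (continuant a c n) x = continuant (\<lambda>i. poly (a i) x) (\<lambda>i. poly (c i) x) n"
  by (induction a c n rule: continuant.induct) auto

text \<open>
  Laplace expansion along the last row leaves two terms. The minor of the off-diagonal one has a
  single nonzero entry in its own last column, so a second expansion reaches the leading minor two
  sizes down. Stating this over any commutative ring makes it apply to matrices of polynomials.
\<close>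

lemma det_tridiagonal:
  fixes f :: "nat \<Rightarrow> nat \<Rightarrow> 'a::comm_ring_1"
  assumes "\<And>i j. i < n \<Longrightarrow> j < n \<Longrightarrow> i + 1 < j \<or> j + 1 < i \<Longrightarrow> f i j = 0"
  shows "det (mat n n (\<lambda>(i, j). f i j)) =
    continuant (\<lambda>i. f i i) (\<lambda>i. f i (Suc i) * f (Suc i) i) n"
  using assms
proof (induction n rule: less_induct)
  case (less n)
  let ?M = "\<lambda>n. mat n n (\<lambda>(i, j). f i j)"
  let ?c = "\<lambda>n. continuant (\<lambda>i. f i i) (\<lambda>i. f i (Suc i) * f (Suc i) i) n"
  consider "n = 0" | "n = 1" | k where "n = Suc (Suc k)"
    by (metis One_nat_def not0_implies_Suc)
  then show ?case
  proof cases
    case 1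
    then show ?thesis by (simp add: det_dim_zero)
  next
    case 2
    then show ?thesis by (simp add: det_single)
  next
    case (3 k)
    define A where "A = ?M (Suc (Suc k))"
    have A: "A \<in> carrier_mat (Suc (Suc k)) (Suc (Suc k))"
      by (simp add: A_def)
    define N where "N = mat_delete A (Suc k) k"
    have N: "N \<in> carrier_mat (Suc k) (Suc k)"
      using mat_delete_carrier[OF A] by (simp add: N_def)
    have "det N = (\<Sum>i<Suc k. N $$ (i, k) * cofactor N i k)"
      by (rule laplace_expansion_column[OF N]) simp
    also have "\<dots> = N $$ (k, k) * cofactor N k k"
    proof -
      have "N $$ (i, k) = 0" if "i < k" for i
        using that less.prems[of i "Suc k"] 3 by (simp add: N_def A_def mat_delete_def)
      then show ?thesis by simp
    qed
    also have "mat_delete N k k = ?M k"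
      by (rule eq_matI) (auto simp: N_def A_def mat_delete_def)
    then have "cofactor N k k = ?c k"
      using less.IH[of k] less.prems 3 by (simp add: cofactor_def)
    also have "N $$ (k, k) = f k (Suc k)"
      by (simp add: N_def A_def mat_delete_def)
    finally have detN: "det N = f k (Suc k) * ?c k" .
    have "mat_delete A (Suc k) (Suc k) = ?M (Suc k)"
      by (rule eq_matI) (auto simp: A_def mat_delete_def)
    then have cof: "cofactor A (Suc k) (Suc k) = ?c (Suc k)"
      using less.IH[of "Suc k"] less.prems 3 by (simp add: cofactor_def)
    have "det A = (\<Sum>j<Suc (Suc k). A $$ (Suc k, j) * cofactor A (Suc k) j)"
      by (rule laplace_expansion_row[OF A]) simp
    also have "\<dots> = A $$ (Suc k, k) * cofactor A (Suc k) k
                    + A $$ (Suc k, Suc k) * cofactor A (Suc k) (Suc k)"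
    proof -
      have "A $$ (Suc k, j) = 0" if "j < k" for j
        using that less.prems[of "Suc k" j] 3 by (simp add: A_def)
      then show ?thesis by simp
    qed
    also have "\<dots> = f (Suc k) k * - (f k (Suc k) * ?c k) + f (Suc k) (Suc k) * ?c (Suc k)"
    proof -
      have "cofactor A (Suc k) k = - (f k (Suc k) * ?c k)"
        using detN by (simp add: cofactor_def N_def)
      moreover have "A $$ (Suc k, k) = f (Suc k) k" "A $$ (Suc k, Suc k) = f (Suc k) (Suc k)"
        by (simp_all add: A_def)
      ultimately show ?thesis by (simp add: cof)
    qed
    finally show ?thesis
      using 3 by (simp add: A_def algebra_simps)
  qed
qed

section \<open>Sign variations of a Sturm chain\<close>

definition sturm_chain :: "(nat \<Rightarrow> real \<Rightarrow> real) \<Rightarrow> nat \<Rightarrow> bool" where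
  "sturm_chain d n \<longleftrightarrow>
     (\<forall>k x. isCont (d k) x) \<and> (\<forall>x. d 0 x \<noteq> 0) \<and>
     (\<forall>k x. Suc (Suc k) \<le> n \<longrightarrow> d (Suc k) x = 0 \<longrightarrow> d k x * d (Suc (Suc k)) x < 0)"

text \<open>
  Variations are counted along the pairs \<open>(d\<^sub>i, d\<^sub>i\<^sub>+\<^sub>1)\<close>. A zero is treated as having the sign opposite
  to its predecessor: then an inner zero of a Sturm chain contributes exactly one variation, the
  same number as at nearby points, and no zeros have to be dropped from the sequence.
\<close>

definition variations :: "(nat \<Rightarrow> real \<Rightarrow> real) \<Rightarrow> nat \<Rightarrow> real \<Rightarrow> int" where
  "variations d n x =
     (\<Sum>i<n. of_bool (d i x * d (Suc i) x < 0 \<or> d (Suc i) x = 0))"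

lemma variations_0 [simp]: "variations d 0 x = 0"
  by (simp add: variations_def)

lemma variations_Suc:
  "variations d (Suc n) x =
     variations d n x + of_bool (d n x * d (Suc n) x < 0 \<or> d (Suc n) x = 0)"
  by (simp add: variations_def)

lemma sturm_chain_no_consecutive_zeros:
  assumes "sturm_chain d n" "Suc k \<le> n" "d (Suc k) x = 0"
  shows "d k x \<noteq> 0"
proof (cases k)
  case 0
  then show ?thesis using assms by (simp add: sturm_chain_def)
next
  case (Suc j)
  then show ?thesis using assms unfolding sturm_chain_def
    by (metis less_irrefl mult_zero_right)
qed

lemma eventually_sgn_eq_nhds:
  fixes f :: "real \<Rightarrow> real"
  assumes "isCont f x0" "f x0 \<noteq> 0"
  shows "\<forall>\<^sub>F x in nhds x0. sgn (f x) = sgn (f x0)"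
proof -
  have lim: "(f \<longlongrightarrow> f x0) (nhds x0)"
    using assms(1) by (simp add: isCont_def tendsto_at_iff_tendsto_nhds)
  consider "f x0 > 0" | "f x0 < 0" using assms(2) by linarith
  then show ?thesis
  proof cases
    case 1
    then show ?thesis using order_tendstoD(1)[OF lim 1] by (auto elim: eventually_mono)
  next
    case 2
    then show ?thesis using order_tendstoD(2)[OF lim 2] by (auto elim: eventually_mono)
  qed
qed

text \<open>
  If the last term is nonzero at a point, its sign is fixed nearby. If the term before it is nonzero
  as well, the last pair contributes a constant and the rest is handled by induction. Otherwise the
  induction steps back two places: the outer two of the last three terms have opposite signs nearby,
  so whatever the sign of the middle one, it produces exactly one variation.
\<close>

lemma variations_locally_constant:
  assumes "sturm_chain d n" "k \<le> n" "d k x0 \<noteq> 0"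
  shows "\<forall>\<^sub>F x in nhds x0. variations d k x = variations d k x0"
  using assms(2,3)
proof (induction k rule: less_induct)
  case (less k)
  have cont: "isCont (d i) x0" for i
    using assms(1) by (simp add: sturm_chain_def)
  note keep = eventually_sgn_eq_nhds[OF cont]
  show ?case
  proof (cases k)
    case 0
    then show ?thesis by simp
  next
    case k: (Suc j)
    show ?thesis
    proof (cases "d j x0 = 0")
      case False
      have "\<forall>\<^sub>F x in nhds x0. variations d j x = variations d j x0"
        using less.IH[of j] less.prems False k by simp
      then show ?thesis
        using keep[OF False] keep[OF less.prems(2)]
      proof eventually_elim
        case (elim x)
        have "sgn (d j x * d k x) = sgn (d j x0 * d k x0)" "d k x \<noteq> 0"
          using elim less.prems(2) by (auto simp: sgn_mult sgn_0_0)
        then have "d j x * d k x < 0 \<longleftrightarrow> d j x0 * d k x0 < 0"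
          by (metis sgn_less)
        with elim(1) \<open>d k x \<noteq> 0\<close> less.prems(2) show ?case
          by (simp add: k variations_Suc)
      qed
    next
      case True
      obtain i where j: "j = Suc i"
        using True assms(1) by (cases j) (auto simp: sturm_chain_def)
      have neg: "d i x0 * d k x0 < 0"
        using assms(1) True less.prems(1) k j by (simp add: sturm_chain_def)
      then have nz: "d i x0 \<noteq> 0" by auto
      have "\<forall>\<^sub>F x in nhds x0. variations d i x = variations d i x0"
        using less.IH[of i] less.prems nz k j by simp
      then show ?thesis
        using keep[OF nz] keep[OF less.prems(2)]
      proof eventually_elim
        case (elim x)
        have one: "of_bool (d i y * d j y < 0 \<or> d j y = 0)
                 + of_bool (d j y * d k y < 0 \<or> d k y = 0) = (1::int)"
          if "d i y * d k y < 0" for y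
          using that by (auto simp: mult_less_0_iff)
        have "sgn (d i x * d k x) = sgn (d i x0 * d k x0)"
          using elim by (simp add: sgn_mult)
        then have "d i x * d k x < 0"
          using neg by (metis sgn_less)
        with elim(1) one[of x] one[of x0] neg show ?case
          by (simp add: k j variations_Suc)
      qed
    qed
  qed
qed

text \<open>
  At a root of the last term the shorter chain is locally constant, so only the last pair can change
  its contribution. That pair counts as a variation at the root itself, so \<open>variations\<close> attains a
  local maximum there.
\<close>

lemma variations_at_zero:
  assumes "sturm_chain d n" "d n x0 = 0"
  shows "\<forall>\<^sub>F x in nhds x0. variations d n x \<le> variations d n x0 \<and>
                          variations d n x0 \<le> variations d n x + 1"
proof -
  obtain k where n: "n = Suc k"
    using assms by (cases n) (auto simp: sturm_chain_def)
  have "d k x0 \<noteq> 0"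
    using sturm_chain_no_consecutive_zeros[OF assms(1)] assms(2) n by simp
  then have "\<forall>\<^sub>F x in nhds x0. variations d k x = variations d k x0"
    using variations_locally_constant[OF assms(1)] n by simp
  then show ?thesis
    by eventually_elim (use assms(2) n in \<open>simp add: variations_Suc\<close>)
qed

lemma locally_nondecreasing_imp_le:
  fixes h :: "real \<Rightarrow> int"
  assumes "a \<le> b"
    and loc: "\<And>x. \<forall>\<^sub>F y in nhds x. (y \<le> x \<longrightarrow> h y \<le> h x) \<and> (x \<le> y \<longrightarrow> h x \<le> h y)"
  shows "h a \<le> h b"
  using assms(1)
proof (induction rule: Bolzano)
  case (trans a b c)
  then show ?case by linarith
next
  case (local x)
  obtain e where e: "e > 0"
    "\<And>y. dist y x < e \<Longrightarrow> (y \<le> x \<longrightarrow> h y \<le> h x) \<and> (x \<le> y \<longrightarrow> h x \<le> h y)"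
    using loc[of x] unfolding eventually_nhds_metric by blast
  have "h a \<le> h b" if "a \<le> x" "x \<le> b" "b - a < e" for a b
  proof -
    have "h a \<le> h x" using e(2)[of a] that by (simp add: dist_real_def)
    also have "h x \<le> h b" using e(2)[of b] that by (simp add: dist_real_def)
    finally show ?thesis .
  qed
  with e(1) show ?case by blast
qed

lemma variations_drop_le_card_zeros:
  assumes chain: "sturm_chain d n" and fin: "finite {x. d n x = 0}" and "a \<le> b"
  shows "variations d n a - variations d n b \<le> int (card {x. d n x = 0})"
proof -
  define Z where "Z = {x. d n x = 0}"
  have finZ: "finite {z \<in> Z. P z}" for P
    using fin by (simp add: Z_def)
  \<comment> \<open>The number of roots strictly below \<open>x\<close> rises just to the right of a root, by one. As
    \<open>variations\<close> is locally maximal at a root, it can rise only towards the root and fall only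
    after it, where the jump compensates the fall. So the sum is locally nondecreasing.\<close>
  define h where "h x = variations d n x + int (card {z \<in> Z. z < x})" for x
  have "h a \<le> h b"
  proof (rule locally_nondecreasing_imp_le[OF \<open>a \<le> b\<close>])
    fix x0
    have "finite (Z - {x0})" using fin by (simp add: Z_def)
    then have "open (- (Z - {x0}))" by (intro open_Compl finite_imp_closed)
    then have iso0: "\<forall>\<^sub>F x in nhds x0. x \<in> - (Z - {x0})"
      by (rule eventually_nhds_in_open) simp
    have mono: "card {z \<in> Z. z < x} \<le> card {z \<in> Z. z < y}" if "x \<le> y" for x y
      using that by (intro card_mono finZ) auto
    show "\<forall>\<^sub>F y in nhds x0. (y \<le> x0 \<longrightarrow> h y \<le> h x0) \<and> (x0 \<le> y \<longrightarrow> h x0 \<le> h y)"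
    proof (cases "d n x0 = 0")
      case False
      from variations_locally_constant[OF chain order_refl this]
      show ?thesis
        by eventually_elim (use mono in \<open>auto simp: h_def\<close>)
    next
      case True
      have jump: "card {z \<in> Z. z < x0} + 1 \<le> card {z \<in> Z. z < y}" if "x0 < y" for y
      proof -
        have "card {z \<in> Z. z < x0} + 1 = card (insert x0 {z \<in> Z. z < x0})"
          using finZ by simp
        also have "\<dots> \<le> card {z \<in> Z. z < y}"
          using that True by (intro card_mono finZ) (auto simp: Z_def)
        finally show ?thesis .
      qed
      from variations_at_zero[OF chain True] show ?thesis
      proof eventually_elim
        case (elim y)
        have "h x0 \<le> h y" if "x0 < y"
          using elim jump[OF that] by (simp add: h_def)
        then have "h x0 \<le> h y" if "x0 \<le> y"
          using that by (cases "x0 = y") auto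
        moreover have "h y \<le> h x0" if "y \<le> x0"
          using elim mono[OF that] by (simp add: h_def)
        ultimately show ?case by blast
      qed
    qed
  qed
  moreover have "card {z \<in> Z. z < b} \<le> card Z"
    using fin by (intro card_mono) (auto simp: Z_def)
  ultimately show ?thesis by (simp add: h_def Z_def)
qed

section \<open>The chain of leading minors\<close>

text \<open>
  At a zero of one term the recurrence makes the next term a negative multiple of the preceding one.
  A common zero of two consecutive terms would propagate down to the constant first term.
\<close>

lemma sturm_chain_continuant:
  fixes \<epsilon> t c :: "nat \<Rightarrow> real"
  assumes "\<And>i. Suc i < n \<Longrightarrow> c i > 0"
  shows "sturm_chain (\<lambda>k x. continuant (\<lambda>i. x * \<epsilon> i - t i) c k) n"
proof -
  let ?d = "\<lambda>k x. continuant (\<lambda>i. x * \<epsilon> i - t i) c k"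
  have nz: "?d k x \<noteq> 0" if "Suc k \<le> n" "?d (Suc k) x = 0" for k x
    using that
  proof (induction k)
    case (Suc k)
    show ?case
    proof
      assume 0: "?d (Suc k) x = 0"
      with Suc.prems(2) have "c k * ?d k x = 0" by simp
      moreover have "c k > 0" using assms Suc.prems(1) by simp
      ultimately show False using Suc.IH 0 Suc.prems(1) by auto
    qed
  qed simp
  have "isCont (?d k) x" for k x
  proof (induction k rule: less_induct)
    case (less k)
    consider "k = 0" | "k = 1" | j where "k = Suc (Suc j)"
      by (metis One_nat_def not0_implies_Suc)
    then show ?case
      by cases (use less in \<open>auto intro!: continuous_intros\<close>)
  qed
  moreover have "?d k x * ?d (Suc (Suc k)) x < 0"
    if "Suc (Suc k) \<le> n" "?d (Suc k) x = 0" for k x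
  proof -
    have "?d k x * ?d (Suc (Suc k)) x = - (c k * (?d k x * ?d k x))"
      using that(2) by simp
    moreover have "c k > 0" "?d k x * ?d k x > 0"
      using assms nz[of k x] that by (auto simp: zero_less_mult_iff linorder_neq_iff)
    ultimately show ?thesis by simp
  qed
  ultimately show ?thesis by (simp add: sturm_chain_def)
qed

text \<open>
  One step of the recurrence far from the origin: the contribution \<open>x * e * u\<close> outweighs the others
  by at least \<open>\<bar>u\<bar>\<close>. That the absolute value does not decrease is what bounds the subtracted term
  in the following step.
\<close>

lemma dominant_linear_factor:
  fixes x e t c u r :: real
  assumes "\<bar>e\<bar> = 1" "\<bar>x\<bar> \<ge> 1 + \<bar>t\<bar> + \<bar>c\<bar>" "u \<noteq> 0" "\<bar>r\<bar> \<le> \<bar>c\<bar> * \<bar>u\<bar>"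
  defines "w \<equiv> (x * e - t) * u - r"
  shows "\<bar>u\<bar> \<le> \<bar>w\<bar>" and "sgn (u * w) = sgn x * e"
proof -
  \<comment> \<open>With \<open>s\<close> the expected sign, \<open>u * u \<le> s * (u * w)\<close> yields both claims.\<close>
  define s where "s = sgn x * e"
  have "x \<noteq> 0" using assms(2) by auto
  then have s: "\<bar>s\<bar> = 1" using assms(1) by (simp add: s_def abs_mult abs_sgn_eq)
  have ss: "s * s = 1" using s by (metis abs_mult_self_eq mult_1)
  have "x * e = s * \<bar>x\<bar>" by (simp add: s_def sgn_if)
  then have "s * (u * w) = \<bar>x\<bar> * (s * s) * (u * u) - s * (t * (u * u) + r * u)"
    by (simp add: w_def algebra_simps)
  then have suw: "s * (u * w) = \<bar>x\<bar> * (u * u) - s * (t * (u * u) + r * u)"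
    by (simp add: ss)
  have "s * (t * (u * u) + r * u) \<le> \<bar>s * (t * (u * u) + r * u)\<bar>"
    by (rule abs_ge_self)
  also have "\<dots> = \<bar>t * (u * u) + r * u\<bar>" using s by (simp add: abs_mult)
  also have "\<dots> \<le> \<bar>t * (u * u)\<bar> + \<bar>r * u\<bar>" by (rule abs_triangle_ineq)
  also have "\<dots> \<le> \<bar>t\<bar> * (u * u) + \<bar>c\<bar> * (u * u)"
    using mult_right_mono[OF assms(4), of "\<bar>u\<bar>"] by (simp add: abs_mult mult.assoc)
  finally have err: "s * (t * (u * u) + r * u) \<le> (\<bar>t\<bar> + \<bar>c\<bar>) * (u * u)"
    by (simp add: distrib_right)
  have "(1 + \<bar>t\<bar> + \<bar>c\<bar>) * (u * u) \<le> \<bar>x\<bar> * (u * u)"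
    by (rule mult_right_mono[OF assms(2)]) simp
  with suw err have main: "u * u \<le> s * (u * w)" by (simp add: distrib_right)
  have "s * (u * w) \<le> \<bar>u\<bar> * \<bar>w\<bar>"
    using abs_ge_self[of "s * (u * w)"] s by (simp add: abs_mult)
  with main have "\<bar>u\<bar> * \<bar>u\<bar> \<le> \<bar>u\<bar> * \<bar>w\<bar>" by simp
  then show "\<bar>u\<bar> \<le> \<bar>w\<bar>" using assms(3) by (meson mult_le_cancel_left_pos zero_less_abs_iff)
  have "0 < u * u" using assms(3) by (auto simp: zero_less_mult_iff)
  with main have "0 < s * (u * w)" by linarith
  moreover have "s = 1 \<or> s = -1" using s by linarith
  ultimately have "sgn (u * w) = s" by (auto simp: sgn_if)
  then show "sgn (u * w) = sgn x * e" by (simp add: s_def)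
qed

lemma continuant_signs_far_out:
  fixes \<epsilon> t c :: "nat \<Rightarrow> real"
  assumes eps: "\<And>i. i < n \<Longrightarrow> \<bar>\<epsilon> i\<bar> = 1"
    and x: "\<bar>x\<bar> \<ge> 1 + (\<Sum>i<n. \<bar>t i\<bar>) + (\<Sum>i<n. \<bar>c i\<bar>)"
    and "k < n"
  defines "d \<equiv> continuant (\<lambda>i. x * \<epsilon> i - t i) c"
  shows "d k \<noteq> 0 \<and> \<bar>d k\<bar> \<le> \<bar>d (Suc k)\<bar> \<and> sgn (d k * d (Suc k)) = sgn x * \<epsilon> k"
proof -
  have far: "\<bar>x\<bar> \<ge> 1 + \<bar>t i\<bar> + \<bar>c j\<bar>" if "i < n" "j < n" for i j
    using x that member_le_sum[of i "{..<n}" "\<lambda>i. \<bar>t i\<bar>"]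
      member_le_sum[of j "{..<n}" "\<lambda>j. \<bar>c j\<bar>"] by simp
  show ?thesis
    using \<open>k < n\<close>
  proof (induction k)
    case 0
    have "d 0 = 1" "d (Suc 0) = (x * \<epsilon> 0 - t 0) * 1 - 0" by (simp_all add: d_def)
    then show ?case
      using dominant_linear_factor[OF eps[OF 0] far[OF 0 0], of 1 0] by simp
  next
    case (Suc k)
    then have u: "d (Suc k) \<noteq> 0" and r: "\<bar>c k * d k\<bar> \<le> \<bar>c k\<bar> * \<bar>d (Suc k)\<bar>"
      by (auto simp: abs_mult intro: mult_left_mono)
    have k: "k < n" using Suc.prems by simp
    have "d (Suc (Suc k)) = (x * \<epsilon> (Suc k) - t (Suc k)) * d (Suc k) - c k * d k"
      by (simp add: d_def)
    then show ?case
      using dominant_linear_factor[OF eps[OF Suc.prems] far[OF Suc.prems k] u r] u by simp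
  qed
qed

lemma variations_continuant_far_out:
  fixes \<epsilon> t c :: "nat \<Rightarrow> real"
  assumes eps: "\<And>i. i < n \<Longrightarrow> \<bar>\<epsilon> i\<bar> = 1"
    and x: "\<bar>x\<bar> \<ge> 1 + (\<Sum>i<n. \<bar>t i\<bar>) + (\<Sum>i<n. \<bar>c i\<bar>)"
  shows "variations (\<lambda>k x. continuant (\<lambda>i. x * \<epsilon> i - t i) c k) n x =
           int (card {i. i < n \<and> \<epsilon> i = - sgn x})"
    and "continuant (\<lambda>i. x * \<epsilon> i - t i) c n \<noteq> 0"
proof -
  let ?d = "continuant (\<lambda>i. x * \<epsilon> i - t i) c"
  note far = continuant_signs_far_out[where \<epsilon> = \<epsilon> and t = t and c = c, OF eps x]
  have nz: "?d (Suc k) \<noteq> 0" if "k < n" for k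
    using far[OF _ that] by auto
  then show "?d n \<noteq> 0" by (cases n) auto
  have "x \<noteq> 0"
  proof
    assume "x = 0"
    moreover have "0 \<le> (\<Sum>i<n. \<bar>t i\<bar>)" "0 \<le> (\<Sum>i<n. \<bar>c i\<bar>)" by (auto intro: sum_nonneg)
    ultimately show False using x by linarith
  qed
  have "(?d k * ?d (Suc k) < 0 \<or> ?d (Suc k) = 0) \<longleftrightarrow> \<epsilon> k = - sgn x" if "k < n" for k
  proof -
    have "?d k * ?d (Suc k) < 0 \<longleftrightarrow> sgn x * \<epsilon> k < 0"
      using far[OF _ that] by (metis sgn_less)
    also have "\<dots> \<longleftrightarrow> \<epsilon> k = - sgn x"
      using eps[OF that] \<open>x \<noteq> 0\<close> by (auto simp: sgn_if abs_if split: if_splits)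
    finally show ?thesis using nz[OF that] by simp
  qed
  then have "variations (\<lambda>k x. continuant (\<lambda>i. x * \<epsilon> i - t i) c k) n x
           = (\<Sum>k<n. of_bool (\<epsilon> k = - sgn x))"
    by (simp add: variations_def)
  also have "\<dots> = int (card {i. i < n \<and> \<epsilon> i = - sgn x})"
    by (simp add: Int_def)
  finally show "variations (\<lambda>k x. continuant (\<lambda>i. x * \<epsilon> i - t i) c k) n x
           = int (card {i. i < n \<and> \<epsilon> i = - sgn x})" .
qed

section \<open>The signature of a signature matrix\<close>

lemma order_prod_linear:
  "Polynomial.order (a::real) (\<Prod>b\<leftarrow>bs. [:- b, 1:]) = count_list bs a"
proof -
  have "Polynomial.order a (\<Prod>b\<leftarrow>bs. [:- b, 1:]) =
      (\<Sum>b\<leftarrow>bs. Polynomial.order a [:- b, 1:])"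
    by (subst order_prod_list) (auto simp: o_def)
  also have "\<dots> = count_list bs a"
    by (induction bs) (auto simp: order_linear')
  finally show ?thesis .
qed

text \<open>
  The characteristic polynomial of a diagonal matrix splits into the linear factors of the diagonal
  entries, so the multiplicity of an eigenvalue counts its occurrences on the diagonal. The sums
  defining the signature range over subsets of \<open>{1}\<close> and \<open>{-1}\<close>, proper ones when a sign is
  absent; the missing summand is then \<open>0\<close>.
\<close>

lemma signature_signature_mat:
  assumes J: "J \<in> carrier_mat n n" and sig: "signature_mat J"
  shows "signature J = int (card {i. i < n \<and> J $$ (i, i) = 1})
                     - int (card {i. i < n \<and> J $$ (i, i) = -1})"
proof -
  have ut: "upper_triangular J"
    using sig J by (auto simp: signature_mat_def diagonal_mat_def)
  have cp: "char_poly J = (\<Prod>a\<leftarrow>diag_mat J. [:- a, 1:])"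
    by (rule char_poly_upper_triangular[OF J ut])
  have ord: "Polynomial.order a (char_poly J) = card {i. i < n \<and> J $$ (i, i) = a}" for a
  proof -
    have "Polynomial.order a (char_poly J) = count_list (diag_mat J) a"
      by (simp add: cp order_prod_linear)
    also have "\<dots> = card {i. i < length (diag_mat J) \<and> a = diag_mat J ! i}"
      by (simp add: count_list_eq_length_filter length_filter_conv_card)
    also have "{i. i < length (diag_mat J) \<and> a = diag_mat J ! i} = {i. i < n \<and> J $$ (i, i) = a}"
      using J by (auto simp: diag_mat_def)
    finally show ?thesis .
  qed
  have monic: "char_poly J \<noteq> 0"
    using degree_monic_char_poly[OF J] by auto
  have ev: "eigenvalue J a \<longleftrightarrow> {i. i < n \<and> J $$ (i, i) = a} \<noteq> {}" for a
    using eigenvalue_root_char_poly[OF J, of a] monic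
    by (simp add: order_root ord card_eq_0_iff)
  have val: "J $$ (i, i) = -1 \<or> J $$ (i, i) = 1" if "i < n" for i
    using sig J that by (auto simp: signature_mat_def)
  have sub: "{a. eigenvalue J a \<and> a > 0} \<subseteq> {1}" "{a. eigenvalue J a \<and> a < 0} \<subseteq> {-1}"
    using val by (fastforce simp: ev)+
  have "(\<Sum>a | eigenvalue J a \<and> a > 0. Polynomial.order a (char_poly J))
      = (\<Sum>a\<in>{1}. Polynomial.order a (char_poly J))"
    using sub(1) by (intro sum.mono_neutral_left) (auto simp: ev ord)
  moreover have "(\<Sum>a | eigenvalue J a \<and> a < 0. Polynomial.order a (char_poly J))
      = (\<Sum>a\<in>{-1}. Polynomial.order a (char_poly J))"
    using sub(2) by (intro sum.mono_neutral_left) (auto simp: ev ord)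
  ultimately show ?thesis by (simp add: signature_def ord)
qed

section \<open>Counting the real roots\<close>

theorem theorem3p3:
  fixes n :: nat and T J :: "real mat" and p :: "real poly"
  assumes "n \<ge> 1"
    and "T \<in> carrier_mat n n"
    and "transpose_mat T = T"
    and "tridiagonal_mat T"
    and "\<And>i. i + 1 < n \<Longrightarrow> T $$ (i, i + 1) \<noteq> 0"
    and "J \<in> carrier_mat n n"
    and "signature_mat J"
    and "J $$ (n - 1, n - 1) = 1"
    and "p = Polynomial.smult (det J) (det (linear_pencil J T))"
    and "rsquarefree (map_poly complex_of_real p)"
  shows "int (card {x. poly p x = 0}) \<ge> signature J"
proof -
  define \<epsilon> t c where "\<epsilon> i = J $$ (i, i)" and "t i = T $$ (i, i)"
    and "c i = (T $$ (i, i + 1))\<^sup>2" for i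
  define d where "d k x = continuant (\<lambda>i. x * \<epsilon> i - t i) c k" for k x
  have T: "T $$ (j, i) = T $$ (i, j)" if "i < n" "j < n" for i j
    using assms(2,3) that by (metis carrier_matD index_transpose_mat(1))
  have ut: "upper_triangular J"
    using assms(6,7) by (auto simp: signature_mat_def diagonal_mat_def)
  have eps1: "\<epsilon> i = -1 \<or> \<epsilon> i = 1" if "i < n" for i
    using assms(6,7) that by (auto simp: signature_mat_def \<epsilon>_def)
  then have eps: "\<bar>\<epsilon> i\<bar> = 1" if "i < n" for i
    using that by fastforce

  let ?P = "linear_pencil J T"
  let ?f = "\<lambda>i j. [:- (T $$ (i, j)), J $$ (i, j):]"
  have pencil: "?P = mat n n (\<lambda>(i, j). ?f i j)"
    using assms(2,6) by (intro eq_matI) (auto simp: linear_pencil_def)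
  have tri: "?f i j = 0" if "i < n" "j < n" "i + 1 < j \<or> j + 1 < i" for i j
    using that assms(2,4,6,7) by (auto simp: tridiagonal_mat_def signature_mat_def diagonal_mat_def)
  have "det ?P = continuant (\<lambda>i. ?f i i) (\<lambda>i. ?f i (Suc i) * ?f (Suc i) i) n"
    unfolding pencil by (rule det_tridiagonal) (rule tri)
  have "poly (det ?P) x = d n x" for x
    unfolding d_def \<open>det ?P = _\<close> poly_continuant
  proof (intro continuant_cong)
    fix i assume "Suc i < n"
    moreover from this have "J $$ (i, Suc i) = 0" "J $$ (Suc i, i) = 0"
      using assms(6,7) by (auto simp: signature_mat_def diagonal_mat_def)
    ultimately show "poly (?f i (Suc i) * ?f (Suc i) i) x = c i"
      using T[of i "Suc i"] by (simp add: c_def power2_eq_square)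
  qed (simp add: \<epsilon>_def t_def)
  moreover have "det J \<noteq> 0"
    using upper_triangular_imp_det_eq_0_iff[OF assms(6) ut] eps1 assms(6)
    by (force simp: diag_mat_def \<epsilon>_def)
  ultimately have roots: "poly p x = 0 \<longleftrightarrow> d n x = 0" for x
    by (simp add: assms(9))

  have chain: "sturm_chain d n"
    unfolding d_def by (rule sturm_chain_continuant) (use assms(5) in \<open>simp add: c_def\<close>)
  \<comment> \<open>Beyond this bound the signs of the chain are those near \<open>\<plusminus>\<infinity>\<close>.\<close>
  define B where "B = 1 + (\<Sum>i<n. \<bar>t i\<bar>) + (\<Sum>i<n. \<bar>c i\<bar>)"
  have "B > 0" unfolding B_def by (simp add: add_pos_nonneg sum_nonneg)
  have "d n B \<noteq> 0"
    unfolding d_def using variations_continuant_far_out(2)[of n \<epsilon> t c B] eps \<open>B > 0\<close>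
    by (simp add: B_def)
  then have "p \<noteq> 0" using roots[of B] by auto
  then have fin: "finite {x. d n x = 0}"
    using poly_roots_finite[of p] by (simp add: roots)

  have "signature J = variations d n (- B) - variations d n B"
    using variations_continuant_far_out(1)[of n \<epsilon> t c B]
      variations_continuant_far_out(1)[of n \<epsilon> t c "- B"] eps \<open>B > 0\<close>
    by (simp add: signature_signature_mat[OF assms(6,7)] d_def[abs_def] \<epsilon>_def B_def)
  also have "\<dots> \<le> int (card {x. d n x = 0})"
    by (rule variations_drop_le_card_zeros[OF chain fin]) (use \<open>B > 0\<close> in simp)
  finally show ?thesis by (simp add: roots)
qed

end
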